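(* Let $G$ be a strongly connected directed graph with node set $N=\{1,\dots,n\}$, and consider any trajectory $({\bf W}(t),{\bf P}(t),{\bf F}(t))_{t\ge 0}$ of the associated AMoD system (described in the context), driven by inputs ${\bf V}(t),{\bf R}(t)$ and arrivals ${\bf d}(t)$, and let $M={\bf 1}_n^T{\bf P}(0)+{\bf 1}_{n(n-1)}^T{\bf F}(0)$ be the total number of vehicles. Then $$ {\bf 1}_{n}^{T}{\bf P}(t)+{\bf 1}_{n(n-1)}^{T}{\bf F}(t)=M\qquad \text{for all } t\ge 0, $$ i.e. the number of vehicles in the network is constant in time.
   Context: Setting. Since $G$ is strongly connected, it is transformed into a complete digraph $\hat G$ on the same nodes $N=\{1,\dots,n\}$ ($n\ge 2$), whose link set $\hat A$ consists of all $n(n-1)$ ordered pairs $(r,s)$ with $r\ne s$ (an actual link of $G$, or else a virtual link standing for a shortest path in $G$). Each link $(r,s)$ has a constant travel time $T_{rs}>0$. ${\bf 1}_k$ is the all-ones column vector of dimension $k$. AMoD system. Variables indexed by links $(r,s)\in\hat A$: $W_{rs}(t)$ (waiting customers), $F_{rs}(t)$ (vehicles traveling on the link), inputs $V_{rs}(t)$ (dispatched customer-carrying vehicles) and $R_{rs}(t)$ (dispatched rebalancing vehicles), arrivals $d_{rs}(t)$. Variables indexed by nodes $r\in N$: $P_r(t)$ (available vehicles). Boldface denotes the corresponding vectors: ${\bf W},{\bf F},{\bf V},{\bf R},{\bf d}\in\mathbb R^{n(n-1)}$, ${\bf P}\in\mathbb R^n$. For $t=0,1,2,\dots$ and all nodes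 $r$ and links $(r,s)$, the dynamics are $$W_{rs}(t+1)=W_{rs}(t)+d_{rs}(t)-V_{rs}(t),$$ $$P_r(t+1)=P_r(t)-\sum_{s\neq r}\bigl(V_{rs}(t)+R_{rs}(t)\bigr)+\sum_{q\ne r}\frac{F_{qr}(t)}{T_{qr}},$$ $$F_{rs}(t+1)=\Bigl(1-\frac1{T_{rs}}\Bigr)F_{rs}(t)+V_{rs}(t)+R_{rs}(t).$$ *)

theory Defs
  imports Complex_Main "Graph_Theory.Graph_Theory"
begin

definition completion :: "'a pair_pre_digraph \<Rightarrow> 'a pair_pre_digraph" where
  "completion G =
     \<lparr> pverts = pverts G, parcs = {(r, s). r \<in> pverts G \<and> s \<in> pverts G \<and> r \<noteq> s} \<rparr>"

lemma pverts_completion [simp]: "pverts (completion G) = pverts G"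
  by (simp add: completion_def)

lemma parcs_completion [simp]:
  "(r, s) \<in> parcs (completion G) \<longleftrightarrow> r \<in> pverts G \<and> s \<in> pverts G \<and> r \<noteq> s"
  by (simp add: completion_def)

lemma card_parcs_completion:
  assumes "finite (pverts G)"
  shows "card (parcs (completion G)) = card (pverts G) * (card (pverts G) - 1)"
proof -
  have "parcs (completion G) = (SIGMA r:pverts G. pverts G - {r})"
    by (auto simp: completion_def)
  then show ?thesis
    using assms by simp
qed

text \<open>
  Vectors indexed by nodes or by links are functions on the node type or on pairs of nodes; only
  their values on \<open>pverts H\<close> and \<open>parcs H\<close> are constrained. The graph \<open>H\<close> is meant to be complete,
  i.e. of the form \<^term>\<open>completion G\<close>, so that the sums over the links leaving or entering \<open>r\<close> range
  over all other nodes. No sign or integrality conditions are imposed on states, inputs and arrivals.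
\<close>

definition amod_trajectory ::
  "'a pair_pre_digraph \<Rightarrow> ('a \<times> 'a \<Rightarrow> real) \<Rightarrow>
   (nat \<Rightarrow> 'a \<times> 'a \<Rightarrow> real) \<Rightarrow> (nat \<Rightarrow> 'a \<times> 'a \<Rightarrow> real) \<Rightarrow> (nat \<Rightarrow> 'a \<times> 'a \<Rightarrow> real) \<Rightarrow>
   (nat \<Rightarrow> 'a \<times> 'a \<Rightarrow> real) \<Rightarrow> (nat \<Rightarrow> 'a \<Rightarrow> real) \<Rightarrow> (nat \<Rightarrow> 'a \<times> 'a \<Rightarrow> real) \<Rightarrow> bool" where
  "amod_trajectory H T V R d W P F \<longleftrightarrow>
     (\<forall>t. \<forall>(r, s) \<in> parcs H. W (Suc t) (r, s) = W t (r, s) + d t (r, s) - V t (r, s)) \<and>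
     (\<forall>t. \<forall>r \<in> pverts H.
        P (Suc t) r = P t r
          - (\<Sum>s \<in> pverts H - {r}. V t (r, s) + R t (r, s))
          + (\<Sum>q \<in> pverts H - {r}. F t (q, r) / T (q, r))) \<and>
     (\<forall>t. \<forall>(r, s) \<in> parcs H.
        F (Suc t) (r, s) = (1 - 1 / T (r, s)) * F t (r, s) + V t (r, s) + R t (r, s))"

end

theory Submission
  imports Defs
begin

text \<open>
  Each link has exactly one tail and one head, so summing a link quantity over the links leaving
  each node, or over those entering each node, gives its sum over all links. Hence in one time step
  the dispatched vehicles lost by the nodes are gained by the links, and the arriving flow
  \<open>F / T\<close> lost by the links is gained by the nodes.
\<close>

lemma sum_parcs_completion_out:
  fixes f :: "'a \<times> 'a \<Rightarrow> 'b::comm_monoid_add"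
  assumes "finite (pverts G)"
  shows "(\<Sum>r \<in> pverts G. \<Sum>s \<in> pverts G - {r}. f (r, s)) = sum f (parcs (completion G))"
proof -
  \<comment> \<open>Grouped by tail, the link set is a dependent sum, so the nested sum collapses to
    a single one.\<close>
  have "parcs (completion G) = (SIGMA r:pverts G. pverts G - {r})"
    by (auto simp: completion_def)
  then show ?thesis
    using assms by (simp add: sum.Sigma)
qed

text \<open>The completion contains each link together with its reverse, so \<open>prod.swap\<close>
  is an involution of the link set; reversing all links reduces this to the outgoing case.\<close>

lemma sum_parcs_completion_in:
  fixes f :: "'a \<times> 'a \<Rightarrow> 'b::comm_monoid_add"
  assumes "finite (pverts G)"
  shows "(\<Sum>r \<in> pverts G. \<Sum>q \<in> pverts G - {r}. f (q, r)) = sum f (parcs (completion G))"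
proof -
  have "(\<Sum>r \<in> pverts G. \<Sum>q \<in> pverts G - {r}. f (q, r))
      = (\<Sum>l \<in> parcs (completion G). f (prod.swap l))"
    using sum_parcs_completion_out[OF assms, of "\<lambda>l. f (prod.swap l)"] by simp
  also have "\<dots> = sum f (parcs (completion G))"
    by (rule sum.reindex_bij_witness[of _ prod.swap prod.swap]) auto
  finally show ?thesis .
qed

lemma amod_vehicles_Suc:
  assumes "finite (pverts G)" and "amod_trajectory (completion G) T V R d W P F"
  shows "sum (P (Suc t)) (pverts G) + sum (F (Suc t)) (parcs (completion G))
       = sum (P t) (pverts G) + sum (F t) (parcs (completion G))"
proof -
  let ?N = "pverts G" and ?A = "parcs (completion G)"
  have "sum (P (Suc t)) ?N
      = (\<Sum>r\<in>?N. P t r - (\<Sum>s \<in> ?N - {r}. V t (r, s) + R t (r, s))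
                + (\<Sum>q \<in> ?N - {r}. F t (q, r) / T (q, r)))"
    using assms(2) by (intro sum.cong) (auto simp: amod_trajectory_def)
  \<comment> \<open>Dispatches \<open>V + R\<close> are grouped by tail, arrivals
    \<open>F / T\<close> by head.\<close>
  also have "\<dots> = sum (P t) ?N - (\<Sum>l\<in>?A. V t l + R t l) + (\<Sum>l\<in>?A. F t l / T l)"
    using sum_parcs_completion_out[OF assms(1), of "\<lambda>l. V t l + R t l"]
      sum_parcs_completion_in[OF assms(1), of "\<lambda>l. F t l / T l"]
    by (simp only: sum.distrib sum_subtractf)
  finally have nodes: "sum (P (Suc t)) ?N
      = sum (P t) ?N - (\<Sum>l\<in>?A. V t l + R t l) + (\<Sum>l\<in>?A. F t l / T l)" .
  \<comment> \<open>Expanding the factor \<open>1 - 1 / T\<close> exposes the same two flows as in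
    \<open>nodes\<close>, with opposite signs, so they cancel in the total.\<close>
  have "F (Suc t) l = F t l + (V t l + R t l) - F t l / T l" if "l \<in> ?A" for l
    using assms(2) that by (cases l) (auto simp: amod_trajectory_def algebra_simps)
  then have "sum (F (Suc t)) ?A = (\<Sum>l\<in>?A. F t l + (V t l + R t l) - F t l / T l)"
    by (intro sum.cong) auto
  then show ?thesis
    using nodes by (simp only: sum.distrib sum_subtractf)
qed

theorem proposition1:
  fixes n :: nat and G :: "nat pair_pre_digraph"
    and T :: "nat \<times> nat \<Rightarrow> real"
    and V R d W F :: "nat \<Rightarrow> nat \<times> nat \<Rightarrow> real"
    and P :: "nat \<Rightarrow> nat \<Rightarrow> real"
    and M :: real
  assumes "n \<ge> 2"
    and "pair_wf_digraph G"
    and "pverts G = {1..n}"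
    and "strongly_connected (with_proj G)"
    and "\<forall>l \<in> parcs (completion G). T l > 0"
    and "amod_trajectory (completion G) T V R d W P F"
    and "M = (\<Sum>r \<in> {1..n}. P 0 r) + (\<Sum>l \<in> parcs (completion G). F 0 l)"
  shows "\<forall>t. (\<Sum>r \<in> {1..n}. P t r) + (\<Sum>l \<in> parcs (completion G). F t l) = M"
proof
  fix t
  have "finite (pverts G)"
    using assms(3) by simp
  \<comment> \<open>The base case is the definition of \<open>M\<close>; the successor case is
    one-step conservation.\<close>
  then show "(\<Sum>r \<in> {1..n}. P t r) + (\<Sum>l \<in> parcs (completion G). F t l) = M"
    using amod_vehicles_Suc[OF _ assms(6)] assms(3,7) by (induction t) simp_all
qed

end
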